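(* Let $k\ge 1$ and let $n, s_1,\ldots,s_k$ be integers with $1\le s_1<s_2<\ldots<s_k<\frac{n}{2}$. Let $G=C_{n}(s_1,s_2,\ldots,s_k)$ be the circulant graph and let $f_G(n)$ be the number of rooted spanning forests in $G$. Then $$f_{G}(n)=\prod_{p=1}^{s_k}|2T_{n}(w_{p})-2|,$$ where $w_{p}$, $p=1,2,\ldots,s_{k}$, are all the (complex) roots, counted with multiplicity, of the algebraic equation $\sum_{j=1}^{k}(2T_{s_{j}}(w)-2)=1$, and $T_{s}(w)$ is the Chebyshev polynomial of the first kind of degree $s$.
   Context: The circulant graph $C_{n}(s_1,\ldots,s_k)$ (with $1\le s_1<\ldots<s_k\le \frac n2$) is the simple undirected graph with vertices $0,1,\ldots,n-1$ in which each vertex $i$ is adjacent to the vertices $i\pm s_1, i\pm s_2,\ldots,i\pm s_k \pmod n$. When $s_k<\frac n2$ all vertices have degree $2k$. A rooted spanning forest of a graph is a spanning acyclic subgraph (containing all the vertices) together with a choice of one distinguished vertex (root) in each connected component. $T_n(z)=\cos(n\arccos z)$ denotes the Chebyshev polynomial of the first kind. *)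

theory Defs
  imports
    "HOL-Analysis.Analysis"
    "HOL-Computational_Algebra.Computational_Algebra"
    "HOL-Number_Theory.Cong"
begin

text \<open>
  A simple undirected graph is given by its vertex set \<open>V\<close> and its set \<open>E\<close> of two-element
  subsets of \<open>V\<close>. The digraph-based notions of \<open>Graph_Theory\<close> are not used because there
  a pair of opposite arcs already counts as a cycle.
\<close>

definition circulant_verts :: "nat \<Rightarrow> nat set" where
  "circulant_verts n = {..<n}"

definition circulant_edges :: "nat \<Rightarrow> nat set \<Rightarrow> nat set set" where
  "circulant_edges n S =
     {{i, j} |i j. i < n \<and> j < n \<and>
        (\<exists>d\<in>S. [int j = int i + int d] (mod int n) \<or> [int j = int i - int d] (mod int n))}"

lemma circulant_edges_simple:
  assumes "\<And>d. d \<in> S \<Longrightarrow> 1 \<le> d \<and> 2 * d \<le> n" and "e \<in> circulant_edges n S"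
  shows "e \<subseteq> circulant_verts n" and "card e = 2"
proof -
  from assms(2) obtain i j d where e: "e = {i, j}" "i < n" "j < n" and d: "d \<in> S"
    and c: "[int j = int i + int d] (mod int n) \<or> [int j = int i - int d] (mod int n)"
    unfolding circulant_edges_def by blast
  show "e \<subseteq> circulant_verts n" using e by (auto simp: circulant_verts_def)
  have "i \<noteq> j"
  proof
    assume "i = j"
    with c have "int n dvd int d" by (auto simp: cong_iff_dvd_diff)
    with assms(1)[OF d] show False by (auto dest: dvd_imp_le)
  qed
  with e show "card e = 2" by simp
qed

text \<open>The vertices of a cycle are listed once; the last one is adjacent to the first one.\<close>

definition is_graph_cycle :: "'a set set \<Rightarrow> 'a list \<Rightarrow> bool" where
  "is_graph_cycle F vs \<longleftrightarrow> length vs \<ge> 3 \<and> distinct vs \<and>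
     (\<forall>i<length vs. {vs ! i, vs ! (Suc i mod length vs)} \<in> F)"

definition acyclic_edges :: "'a set set \<Rightarrow> bool" where
  "acyclic_edges F \<longleftrightarrow> \<not> (\<exists>vs. is_graph_cycle F vs)"

definition graph_components :: "'a set \<Rightarrow> 'a set set \<Rightarrow> 'a set set" where
  "graph_components V F = V // {(u, v). {u, v} \<in> F}\<^sup>*"

text \<open>
  Since a spanning subgraph contains all vertices, it is determined by its edge set \<open>F\<close>.
  The choice of roots is encoded as the set \<open>R\<close> of all roots.
\<close>

definition rooted_spanning_forests :: "'a set \<Rightarrow> 'a set set \<Rightarrow> ('a set set \<times> 'a set) set" where
  "rooted_spanning_forests V E =
     {(F, R). F \<subseteq> E \<and> acyclic_edges F \<and> R \<subseteq> V \<and> (\<forall>C\<in>graph_components V F. \<exists>!r. r \<in> C \<inter> R)}"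

definition chebyshev_T :: "nat \<Rightarrow> complex poly" where
  "chebyshev_T n = (THE p. \<forall>z. poly p z = cos (of_nat n * Arccos z))"

lemma poly_chebyshev_T: "poly (chebyshev_T n) z = cos (of_nat n * Arccos z)"
proof -
  have "(\<exists>p. \<forall>z. poly p z = cos (of_nat n * Arccos z)) \<and>
        (\<exists>p. \<forall>z. poly p z = cos (of_nat (Suc n) * Arccos z))"
  proof (induction n)
    case 0
    show ?case
    proof (intro conjI exI allI)
      fix z :: complex
      show "poly 1 z = cos (of_nat 0 * Arccos z)" by simp
      show "poly [:0, 1:] z = cos (of_nat (Suc 0) * Arccos z)" by simp
    qed
  next
    case (Suc n)
    then obtain p q where
      p: "\<And>z. poly p z = cos (of_nat n * Arccos z)" and
      q: "\<And>z. poly q z = cos (of_nat (Suc n) * Arccos z)"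
      by blast
    have "poly ([:0, 2:] * q - p) z = cos (of_nat (Suc (Suc n)) * Arccos z)" for z
    proof -
      define t where "t = Arccos z"
      define u where "u = of_nat (Suc n) * t"
      have z: "z = cos t" by (simp add: t_def)
      have eqs: "of_nat n * t = u - t" "of_nat (Suc (Suc n)) * t = u + t"
        by (simp_all add: u_def algebra_simps)
      show ?thesis
        unfolding poly_diff poly_mult p q t_def[symmetric] u_def[symmetric] eqs cos_add cos_diff
        by (simp add: z)
    qed
    then show ?case using Suc by blast
  qed
  then obtain p where p: "\<forall>z. poly p z = cos (of_nat n * Arccos z)" by blast
  moreover have "q = p" if "\<forall>z. poly q z = cos (of_nat n * Arccos z)" for q
    using p that by (intro iffD1[OF poly_eq_poly_eq_iff] ext) simp
  ultimately have "chebyshev_T n = p" unfolding chebyshev_T_def by (intro the_equality) blast+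
  with p show ?thesis by simp
qed

end

theory Submission
  imports Defs "Jordan_Normal_Form.Determinant"
begin

text \<open>
  Let \<open>L\<close> be the Laplacian of the graph. The proof evaluates \<open>det (I + L)\<close> in two ways.

  Combinatorially, the determinant counts rooted spanning forests. Orienting every edge of a
  rooted forest towards the root turns the forest into a parent map, that is, a map from the vertices to
  themselves which fixes the roots, sends every other vertex to a neighbour and has no directed
  cycle; this is a bijection (\<open>card_rooted_spanning_forests\<close>). Expanding \<open>det (I + L)\<close>
  multilinearly in its rows gives one determinant per choice of a parent for each vertex, and
  that determinant is 1 for parent maps and 0 if there is a directed cycle (\<open>det_forest_matrix\<close>).

  Spectrally, the characters of the cyclic group diagonalise \<open>I + L\<close>. The eigenvalue at the \<open>m\<close>-th
  character is \<open>- P (cos (2 \<pi> m / n))\<close>, where \<open>P\<close> is the polynomial of the theorem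
  (\<open>det_forest_matrix_circulant\<close>). Since \<open>P\<close> has degree \<open>s k\<close> and leading coefficient \<open>2 ^ s k\<close>
  (\<open>chebyshev_sum_lead\<close>), it is the product of the factors \<open>2 z - 2 w\<close> over its roots \<open>w\<close>. So
  the determinant is, up to sign, the double product of \<open>2 w - 2 cos (2 \<pi> m / n)\<close> over all \<open>w\<close>
  and \<open>m\<close>. Taking the product over \<open>m\<close> first gives \<open>2 T\<^sub>n(w) - 2\<close> (\<open>chebyshev_T_minus_2_prod\<close>).
\<close>

section \<open>Rooted forests as parent maps\<close>

text \<open>
  A rooted forest is recorded by the map that sends every vertex to the next vertex on its path to
  the root, and every root to itself. The height function \<open>h\<close> is what excludes directed cycles; it
  is preferred to a condition on iterates because it permits induction along the map.
  Extensionality outside \<open>V\<close> makes different maps in this set encode different forests.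
\<close>
definition parent_maps :: "'a set \<Rightarrow> 'a set set \<Rightarrow> ('a \<Rightarrow> 'a) set" where
  "parent_maps V E =
     {f \<in> V \<rightarrow>\<^sub>E V. (\<forall>v\<in>V. f v \<noteq> v \<longrightarrow> {v, f v} \<in> E) \<and>
        (\<exists>h :: 'a \<Rightarrow> nat. \<forall>v\<in>V. f v \<noteq> v \<longrightarrow> h (f v) < h v)}"

definition parent_edges :: "'a set \<Rightarrow> ('a \<Rightarrow> 'a) \<Rightarrow> 'a set set" where
  "parent_edges V f = {{v, f v} |v. v \<in> V \<and> f v \<noteq> v}"

definition parent_roots :: "'a set \<Rightarrow> ('a \<Rightarrow> 'a) \<Rightarrow> 'a set" where
  "parent_roots V f = {v \<in> V. f v = v}"

abbreviation adjacency :: "'a set set \<Rightarrow> ('a \<times> 'a) set" where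
  "adjacency F \<equiv> {(u, v). {u, v} \<in> F}"

lemma sym_adjacency_rtrancl: "(u, v) \<in> (adjacency F)\<^sup>* \<Longrightarrow> (v, u) \<in> (adjacency F)\<^sup>*"
proof -
  have "sym (adjacency F)" by (auto simp: sym_def insert_commute)
  then show "(u, v) \<in> (adjacency F)\<^sup>* \<Longrightarrow> (v, u) \<in> (adjacency F)\<^sup>*"
    by (meson sym_rtrancl symE)
qed

lemma parent_edgesD:
  assumes "{u, v} \<in> parent_edges V f"
  shows "u \<in> V \<and> f u = v \<and> u \<noteq> v \<or> v \<in> V \<and> f v = u \<and> u \<noteq> v"
  using assms by (auto simp: parent_edges_def doubleton_eq_iff)

text \<open>
  On an undirected cycle take a vertex of maximal height. Each of its two neighbours is joined to it
  by a parent edge and is not higher, so each of them is its parent; but a vertex has one parent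
  and the two neighbours are distinct.
\<close>
lemma acyclic_parent_edges:
  fixes h :: "'a \<Rightarrow> nat"
  assumes h: "\<And>v. v \<in> V \<Longrightarrow> f v \<noteq> v \<Longrightarrow> h (f v) < h v"
  shows "acyclic_edges (parent_edges V f)"
  unfolding acyclic_edges_def
proof
  assume "\<exists>vs. is_graph_cycle (parent_edges V f) vs"
  then obtain vs where len: "length vs \<ge> 3" and dist: "distinct vs"
    and e: "\<And>i. i < length vs \<Longrightarrow> {vs ! i, vs ! (Suc i mod length vs)} \<in> parent_edges V f"
    unfolding is_graph_cycle_def by blast
  define m where "m = length vs"
  define i where "i = (ARG_MAX (\<lambda>i. h (vs ! i)) i. i < m)"
  have m: "m \<ge> 3" using len by (simp add: m_def)
  have "i < m \<and> (\<forall>j. j < m \<longrightarrow> h (vs ! j) \<le> h (vs ! i))"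
    unfolding i_def
    by (rule arg_max_nat_lemma[of "\<lambda>i. i < m" 0 _ "Suc (Max ((\<lambda>i. h (vs ! i)) ` {..<m}))"])
       (use m in \<open>auto simp: less_Suc_eq_le\<close>)
  then have i: "i < m" and mx: "\<And>j. j < m \<Longrightarrow> h (vs ! j) \<le> h (vs ! i)" by auto
  \<comment> \<open>A neighbour having the highest vertex as its parent would be higher still.\<close>
  have par: "f (vs ! i) = vs ! j" if "j < m" "{vs ! i, vs ! j} \<in> parent_edges V f" for j
  proof -
    have "\<not> (vs ! j \<in> V \<and> f (vs ! j) = vs ! i \<and> vs ! i \<noteq> vs ! j)"
      using h[of "vs ! j"] mx[OF that(1)] by fastforce
    with parent_edgesD[OF that(2)] show ?thesis by blast
  qed
  define p where "p = (if i = 0 then m - 1 else i - 1)"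
  define q where "q = Suc i mod m"
  have pq: "p < m" "q < m" "Suc p mod m = i"
    using m i by (auto simp: p_def q_def)
  have "f (vs ! i) = vs ! q" using par[OF pq(2)] e[of i] i by (simp add: q_def m_def)
  moreover have "f (vs ! i) = vs ! p" using par[OF pq(1)] e[of p] pq by (simp add: m_def insert_commute)
  ultimately have "vs ! p = vs ! q" by simp
  then have "p = q" using dist pq nth_eq_iff_index_eq by (metis m_def)
  moreover have "p \<noteq> q"
    using m i by (cases "Suc i = m") (auto simp: p_def q_def split: if_splits)
  ultimately show False by blast
qed

lemma parent_map_reaches_root:
  fixes h :: "'a \<Rightarrow> nat"
  assumes f: "\<And>v. v \<in> V \<Longrightarrow> f v \<in> V"
    and h: "\<And>v. v \<in> V \<Longrightarrow> f v \<noteq> v \<Longrightarrow> h (f v) < h v"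
    and "v \<in> V"
  shows "\<exists>r\<in>parent_roots V f. (v, r) \<in> (adjacency (parent_edges V f))\<^sup>*"
  using \<open>v \<in> V\<close>
proof (induction "h v" arbitrary: v rule: less_induct)
  case less
  show ?case
  proof (cases "f v = v")
    case True
    then show ?thesis using less.prems by (auto simp: parent_roots_def)
  next
    case False
    then have "(v, f v) \<in> adjacency (parent_edges V f)"
      using less.prems by (auto simp: parent_edges_def)
    moreover obtain r where "r \<in> parent_roots V f"
      "(f v, r) \<in> (adjacency (parent_edges V f))\<^sup>*"
      using less.hyps[OF h[OF less.prems False] f[OF less.prems]] by blast
    ultimately show ?thesis
      by (intro bexI[of _ r] converse_rtrancl_into_rtrancl[of v "f v" _ r])
  qed
qed

text \<open>
  The property of being sent to the root \<open>r\<close> by some iterate of \<open>f\<close> survives a step along a parent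
  edge in either direction, so it holds on the whole component of \<open>r\<close>; a root is sent only to itself.
\<close>
lemma parent_root_unique:
  assumes f: "\<And>v. v \<in> V \<Longrightarrow> f v \<in> V"
    and r: "r \<in> parent_roots V f" and r': "r' \<in> parent_roots V f"
    and conn: "(r, r') \<in> (adjacency (parent_edges V f))\<^sup>*"
  shows "r = r'"
proof -
  have fix_iter: "(f ^^ m) x = x" if "f x = x" for m x
    using that by (induction m) auto
  have inV: "v \<in> V" if "(r, v) \<in> (adjacency (parent_edges V f))\<^sup>*" for v
    using that
  proof (induction rule: rtrancl_induct)
    case base
    then show ?case using r by (simp add: parent_roots_def)
  next
    case (step y z)
    then show ?case using f parent_edgesD[of y z V f] by auto
  qed
  have "\<exists>m. (f ^^ m) v = r" if "(r, v) \<in> (adjacency (parent_edges V f))\<^sup>*" for v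
    using that
  proof (induction rule: rtrancl_induct)
    case base
    show ?case by (rule exI[of _ 0]) simp
  next
    case (step y z)
    then obtain m where m: "(f ^^ m) y = r" by blast
    from step(2) consider "f y = z" | "f z = y" using parent_edgesD[of y z V f] by auto
    then show ?case
    proof cases
      case 1
      have "(f ^^ m) z = f ((f ^^ m) y)" using 1 by (metis funpow_swap1)
      then show ?thesis using m r by (auto simp: parent_roots_def)
    next
      case 2
      then have "(f ^^ Suc m) z = r" using m by (simp add: funpow_swap1)
      then show ?thesis by blast
    qed
  qed
  from this[OF conn] r' show ?thesis by (auto simp: parent_roots_def fix_iter)
qed

lemma parent_map_forest:
  assumes "f \<in> parent_maps V E"
  shows "(parent_edges V f, parent_roots V f) \<in> rooted_spanning_forests V E"
proof -
  from assms obtain h :: "'a \<Rightarrow> nat" where f: "\<And>v. v \<in> V \<Longrightarrow> f v \<in> V"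
    and E: "\<And>v. v \<in> V \<Longrightarrow> f v \<noteq> v \<Longrightarrow> {v, f v} \<in> E"
    and h: "\<And>v. v \<in> V \<Longrightarrow> f v \<noteq> v \<Longrightarrow> h (f v) < h v"
    unfolding parent_maps_def by (auto simp: PiE_def Pi_def)
  let ?A = "adjacency (parent_edges V f)"
  have "\<exists>!r. r \<in> C \<inter> parent_roots V f" if C: "C \<in> graph_components V (parent_edges V f)" for C
  proof -
    from C obtain v where v: "v \<in> V" and C: "C = ?A\<^sup>* `` {v}"
      unfolding graph_components_def by (auto elim: quotientE)
    obtain r where r: "r \<in> parent_roots V f" "(v, r) \<in> ?A\<^sup>*"
      using parent_map_reaches_root[of V f h, OF f h v] by blast
    show ?thesis
    proof (rule ex1I[of _ r])
      show "r \<in> C \<inter> parent_roots V f" using r C by simp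
      fix r' assume "r' \<in> C \<inter> parent_roots V f"
      then have r': "r' \<in> parent_roots V f" "(v, r') \<in> ?A\<^sup>*" using C by auto
      have "(r', r) \<in> ?A\<^sup>*" using sym_adjacency_rtrancl[OF r'(2)] r(2) by (rule rtrancl_trans)
      then show "r' = r" by (intro parent_root_unique[of V f r' r] f r'(1) r(1))
    qed
  qed
  moreover have "parent_edges V f \<subseteq> E" using E by (auto simp: parent_edges_def)
  moreover have "parent_roots V f \<subseteq> V" by (auto simp: parent_roots_def)
  moreover have "acyclic_edges (parent_edges V f)" using acyclic_parent_edges[of V f h] h by blast
  ultimately show ?thesis by (simp add: rooted_spanning_forests_def)
qed

text \<open>
  If \<open>f\<close> and \<open>g\<close> differ at \<open>x\<close>, the edge from \<open>x\<close> to \<open>f x\<close> must be traversed by \<open>g\<close> in the opposite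
  direction, and then the two maps differ at \<open>f x\<close> as well. Following \<open>f\<close> thus gives an infinite
  descent of heights.
\<close>
lemma parent_map_determined:
  assumes f: "f \<in> parent_maps V E" and g: "g \<in> parent_maps V E"
    and F: "parent_edges V f = parent_edges V g" and R: "parent_roots V f = parent_roots V g"
  shows "f = g"
proof (rule ccontr)
  from f obtain h :: "'a \<Rightarrow> nat" where fV: "f \<in> V \<rightarrow>\<^sub>E V"
    and h: "\<And>v. v \<in> V \<Longrightarrow> f v \<noteq> v \<Longrightarrow> h (f v) < h v"
    unfolding parent_maps_def by auto
  have gV: "g \<in> V \<rightarrow>\<^sub>E V" using g by (simp add: parent_maps_def)
  have roots: "f v = v \<longleftrightarrow> g v = v" if "v \<in> V" for v
    using R that by (auto simp: parent_roots_def)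
  have descent: "False" if "x \<in> V" "f x \<noteq> g x" for x
    using that
  proof (induction "h x" arbitrary: x rule: less_induct)
    case less
    have nr: "f x \<noteq> x" using roots[OF less.prems(1)] less.prems(2) by metis
    have y: "f x \<in> V" using fV less.prems(1) by auto
    have "{x, f x} \<in> parent_edges V g"
      unfolding F[symmetric] using less.prems(1) nr by (auto simp: parent_edges_def)
    with less.prems(2) have gy: "g (f x) = x" by (auto dest: parent_edgesD)
    have "f (f x) \<noteq> f x" using roots[OF y] gy nr by metis
    then have "f (f x) \<noteq> x" using h[OF y] h[OF less.prems(1) nr] by fastforce
    then show False using less.hyps[OF h[OF less.prems(1) nr] y] gy by simp
  qed
  assume "f \<noteq> g"
  then obtain x where "f x \<noteq> g x" by blast
  moreover from this have "x \<in> V" using fV gV by (metis PiE_arb)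
  ultimately show False using descent by blast
qed

lemma rtrancl_imp_distinct_path:
  assumes "(u, v) \<in> r\<^sup>*"
  shows "\<exists>p. p \<noteq> [] \<and> distinct p \<and> hd p = u \<and> last p = v \<and> successively (\<lambda>x y. (x, y) \<in> r) p"
  using assms
proof (induction rule: converse_rtrancl_induct)
  case base
  show ?case by (rule exI[of _ "[v]"]) simp
next
  case (step y z)
  then obtain p where p: "p \<noteq> []" "distinct p" "hd p = z" "last p = v"
    "successively (\<lambda>x y. (x, y) \<in> r) p" by blast
  show ?case
  proof (cases "y \<in> set p")
    case False
    then show ?thesis using p step(1)
      by (intro exI[of _ "y # p"]) (auto simp: successively_Cons)
  next
    case True
    then obtain as bs where "p = as @ y # bs" by (meson split_list)
    then show ?thesis using p
      by (intro exI[of _ "y # bs"]) (auto simp: successively_append_iff)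
  qed
qed

text \<open>
  Let every non-root step to a neighbour strictly closer to the root set. All edges obtained lie in
  \<open>F\<close>. Conversely, an edge of \<open>F\<close> that is missing would join two vertices that are already connected
  through their common root by parent edges, and would close a cycle in \<open>F\<close>.
\<close>
lemma forest_is_parent_map:
  assumes E: "\<And>e. e \<in> E \<Longrightarrow> e \<subseteq> V \<and> card e = 2"
    and FR: "(F, R) \<in> rooted_spanning_forests V E"
  shows "\<exists>f\<in>parent_maps V E. parent_edges V f = F \<and> parent_roots V f = R"
proof -
  from FR have FE: "F \<subseteq> E" and acyc: "acyclic_edges F" and RV: "R \<subseteq> V"
    and ex1: "\<And>C. C \<in> graph_components V F \<Longrightarrow> \<exists>!r. r \<in> C \<inter> R"
    unfolding rooted_spanning_forests_def by auto
  let ?A = "adjacency F"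
  have edge: "u \<in> V" "v \<in> V" "u \<noteq> v" if "{u, v} \<in> F" for u v
    using E[of "{u, v}"] FE that by auto
  have comp: "\<exists>!r. r \<in> ?A\<^sup>* `` {v} \<inter> R" if "v \<in> V" for v
  proof -
    have "?A\<^sup>* `` {v} \<in> graph_components V F"
      unfolding graph_components_def using that by (rule quotientI)
    from ex1[OF this] show ?thesis .
  qed
  have reach: "\<exists>m. \<exists>r\<in>R. (v, r) \<in> ?A ^^ m" if "v \<in> V" for v
    using comp[OF that] by (auto simp: rtrancl_power dest!: ex1_implies_ex)
  define d where "d v = (LEAST m. \<exists>r\<in>R. (v, r) \<in> ?A ^^ m)" for v
  have closer: "\<exists>u. {v, u} \<in> F \<and> d u < d v" if v: "v \<in> V" "v \<notin> R" for v
  proof -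
    from LeastI_ex[OF reach[OF v(1)]] obtain r where r: "r \<in> R" "(v, r) \<in> ?A ^^ d v"
      unfolding d_def by blast
    have "d v \<noteq> 0" using r v by (intro notI) auto
    then obtain m where m: "d v = Suc m" using not0_implies_Suc by blast
    with r obtain u where u: "(v, u) \<in> ?A" "(u, r) \<in> ?A ^^ m" by (metis relpow_Suc_D2)
    have "d u \<le> m" unfolding d_def by (rule Least_le) (use u r in blast)
    with u m show ?thesis by auto
  qed
  define f where
    "f = restrict (\<lambda>v. if v \<in> R then v else SOME u. {v, u} \<in> F \<and> d u < d v) V"
  have f_root: "f v = v" if "v \<in> R" for v using that RV by (auto simp: f_def)
  have f_step: "{v, f v} \<in> F" "d (f v) < d v" if "v \<in> V" "v \<notin> R" for v
    using someI_ex[OF closer[OF that]] that by (auto simp: f_def)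
  have fV: "f v \<in> V" if "v \<in> V" for v
    using edge(2)[OF f_step(1)[OF that]] f_root that by metis
  have R_eq: "parent_roots V f = R"
    using f_root RV edge(3)[OF f_step(1)] by (fastforce simp: parent_roots_def)
  have pm: "f \<in> parent_maps V E"
    unfolding parent_maps_def
  proof (intro CollectI conjI ballI impI exI[of _ d])
    show "f \<in> V \<rightarrow>\<^sub>E V" using fV by (auto simp: f_def)
    fix v assume "v \<in> V" "f v \<noteq> v"
    then have "v \<notin> R" using f_root by auto
    then show "{v, f v} \<in> E" "d (f v) < d v" using f_step[OF \<open>v \<in> V\<close>] FE by auto
  qed
  have sub: "parent_edges V f \<subseteq> F"
    using f_step(1) f_root by (fastforce simp: parent_edges_def)
  have "e \<in> parent_edges V f" if "e \<in> F" for e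
  proof (rule ccontr)
    assume ne: "e \<notin> parent_edges V f"
    \<comment> \<open>The path built below avoids \<open>e\<close>, has at least three vertices, and is closed to a cycle by \<open>e\<close>.\<close>
    let ?B = "adjacency (parent_edges V f)"
    from E[of e] FE \<open>e \<in> F\<close> obtain u v where e: "e = {u, v}" by (meson card_2_iff subsetD)
    with \<open>e \<in> F\<close> have uv: "u \<in> V" "v \<in> V" "u \<noteq> v" "(u, v) \<in> ?A" using edge by auto
    have BA: "?B\<^sup>* \<subseteq> ?A\<^sup>*" by (rule rtrancl_mono) (use sub in auto)
    have h: "d (f v) < d v" if "v \<in> V" "f v \<noteq> v" for v
      using f_step(2)[OF that(1)] f_root that(2) by blast
    obtain r where r: "r \<in> R" "(u, r) \<in> ?B\<^sup>*"
      using parent_map_reaches_root[of V f d u] fV h uv(1) R_eq by blast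
    obtain r' where r': "r' \<in> R" "(v, r') \<in> ?B\<^sup>*"
      using parent_map_reaches_root[of V f d v] fV h uv(2) R_eq by blast
    have "(u, r') \<in> ?A\<^sup>*" using uv(4) r'(2) BA by (meson converse_rtrancl_into_rtrancl subsetD)
    then have "r = r'" using comp[OF uv(1)] r r' BA by blast
    with r(2) have "(u, r') \<in> ?B\<^sup>*" by simp
    then have "(u, v) \<in> ?B\<^sup>*" using sym_adjacency_rtrancl[OF r'(2)] by (rule rtrancl_trans)
    then obtain p where p: "p \<noteq> []" "distinct p" "hd p = u" "last p = v"
      "successively (\<lambda>x y. (x, y) \<in> ?B) p"
      using rtrancl_imp_distinct_path[of u v ?B] by blast
    have adj: "{p ! i, p ! Suc i} \<in> parent_edges V f" if "Suc i < length p" for i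
      using p(5) that by (auto simp: successively_conv_nth)
    have ends: "p ! 0 = u" "p ! (length p - 1) = v"
      using p by (auto simp: hd_conv_nth last_conv_nth)
    have "length p \<noteq> 1" using ends uv(3) by auto
    moreover have "length p \<noteq> 2" using ends adj[of 0] ne e by auto
    moreover have "length p \<noteq> 0" using p(1) by simp
    ultimately have len: "length p \<ge> 3" by linarith
    have "{p ! i, p ! (Suc i mod length p)} \<in> F" if "i < length p" for i
    proof (cases "Suc i = length p")
      case True
      then have "p ! i = v" "p ! (Suc i mod length p) = u" using ends by (auto simp flip: True)
      then show ?thesis using \<open>e \<in> F\<close> e by (simp add: insert_commute)
    next
      case False
      then show ?thesis using adj[of i] sub that by auto
    qed
    then have "is_graph_cycle F p" using len p(2) by (simp add: is_graph_cycle_def)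
    with acyc show False by (auto simp: acyclic_edges_def)
  qed
  with sub have "parent_edges V f = F" by blast
  with pm R_eq show ?thesis by blast
qed

lemma card_rooted_spanning_forests:
  assumes "\<And>e. e \<in> E \<Longrightarrow> e \<subseteq> V \<and> card e = 2"
  shows "card (rooted_spanning_forests V E) = card (parent_maps V E)"
proof -
  have "bij_betw (\<lambda>f. (parent_edges V f, parent_roots V f)) (parent_maps V E)
          (rooted_spanning_forests V E)"
    unfolding bij_betw_def
  proof
    show "inj_on (\<lambda>f. (parent_edges V f, parent_roots V f)) (parent_maps V E)"
      by (rule inj_onI) (auto intro: parent_map_determined)
    show "(\<lambda>f. (parent_edges V f, parent_roots V f)) ` parent_maps V E
            = rooted_spanning_forests V E"
      using parent_map_forest forest_is_parent_map[OF assms] by (fastforce simp: image_iff)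
  qed
  then show ?thesis by (simp add: bij_betw_same_card)
qed

section \<open>Rooted forests counted by a determinant\<close>

text \<open>The identity matrix plus the Laplacian of the graph with vertices \<open>{..<n}\<close> and edge set \<open>E\<close>.\<close>
definition forest_matrix :: "nat \<Rightarrow> nat set set \<Rightarrow> 'a :: comm_ring_1 Matrix.mat" where
  "forest_matrix n E = Matrix.mat n n (\<lambda>(i, j).
     if i = j then 1 + of_nat (card {v. {i, v} \<in> E}) else if {i, j} \<in> E then - 1 else 0)"

text \<open>Row \<open>i\<close> is \<open>e\<^sub>i\<close> minus the unit vector of the parent of \<open>i\<close>, and just \<open>e\<^sub>i\<close> when \<open>i\<close> is a root.\<close>
definition parent_matrix :: "nat \<Rightarrow> (nat \<Rightarrow> nat) \<Rightarrow> 'a :: comm_ring_1 Matrix.mat" where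
  "parent_matrix n f = Matrix.mat n n (\<lambda>(i, j). if j = i then 1 else if j = f i then - 1 else 0)"

lemma parent_matrix_carrier [simp]: "parent_matrix n f \<in> carrier_mat n n"
  by (simp add: parent_matrix_def)

text \<open>
  A permutation with a nonzero term in the Leibniz formula moves every point either nowhere or to
  its parent. If it moves \<open>i\<close> to \<open>f i\<close>, injectivity forces it to move \<open>f i\<close> too, which is impossible
  all the way down to a root. So only the identity contributes.
\<close>
lemma det_parent_matrix_acyclic:
  fixes h :: "nat \<Rightarrow> nat"
  assumes f: "\<And>i. i < n \<Longrightarrow> f i < n"
    and h: "\<And>i. i < n \<Longrightarrow> f i \<noteq> i \<Longrightarrow> h (f i) < h i"
  shows "Determinant.det (parent_matrix n f :: 'a :: comm_ring_1 Matrix.mat) = 1"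
proof -
  let ?M = "parent_matrix n f :: 'a Matrix.mat"
  have zero: "(\<Prod>i = 0..<n. ?M $$ (i, p i)) = 0" if p: "p permutes {0..<n}" and "p \<noteq> id" for p
  proof (rule ccontr)
    assume nz: "(\<Prod>i = 0..<n. ?M $$ (i, p i)) \<noteq> 0"
    have step: "p i = f i" if "i < n" "p i \<noteq> i" for i
    proof (rule ccontr)
      assume "p i \<noteq> f i"
      moreover have "p i < n" using permutes_in_image[OF p, of i] that by simp
      ultimately have "?M $$ (i, p i) = 0" using that by (simp add: parent_matrix_def)
      then have "(\<Prod>i = 0..<n. ?M $$ (i, p i)) = 0" using that by (intro prod_zero) auto
      with nz show False ..
    qed
    have "p i = i" if "i < n" for i
      using that
    proof (induction "h i" arbitrary: i rule: less_induct)
      case less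
      show ?case
      proof (rule ccontr)
        assume ne: "p i \<noteq> i"
        then have pf: "p i = f i" using step less.prems by blast
        with ne have "p (f i) = f i" using less.hyps[OF h f] less.prems by simp
        with pf have "p (p i) = p i" by simp
        then have "p i = i" using permutes_inj[OF p] by (simp add: inj_eq)
        with ne show False ..
      qed
    qed
    then have "p = id" using permutes_not_in[OF p] by (auto simp: fun_eq_iff)
    with \<open>p \<noteq> id\<close> show False ..
  qed
  have "Determinant.det ?M = (\<Sum>p | p permutes {0..<n}. signof p * (\<Prod>i = 0..<n. ?M $$ (i, p i)))"
    by (rule det_def') simp
  also have "\<dots> = (\<Sum>p | p permutes {0..<n}. if p = id then 1 else 0)"
    using zero by (intro sum.cong refl) (auto simp: parent_matrix_def)
  also have "\<dots> = 1"
    by (subst sum.delta) (auto simp: finite_permutations permutes_id)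
  finally show ?thesis .
qed

text \<open>
  The vertices whose iterates never reach a fixed point form a set closed under \<open>f\<close> and under taking
  preimages, so its indicator vector is in the kernel. It is not zero, for otherwise the number of
  steps to a fixed point would be a height function.
\<close>
lemma det_parent_matrix_cyclic:
  assumes f: "\<And>i. i < n \<Longrightarrow> f i < n"
    and no_h: "\<not> (\<exists>h :: nat \<Rightarrow> nat. \<forall>i<n. f i \<noteq> i \<longrightarrow> h (f i) < h i)"
  shows "Determinant.det (parent_matrix n f :: 'a :: idom Matrix.mat) = 0"
proof -
  let ?M = "parent_matrix n f :: 'a Matrix.mat"
  define S where "S = {i. \<forall>m. f ((f ^^ m) i) \<noteq> (f ^^ m) i}"
  have "\<exists>i<n. i \<in> S"
  proof (rule ccontr)
    assume "\<not> (\<exists>i<n. i \<in> S)"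
    then have ex: "\<exists>m. f ((f ^^ m) i) = (f ^^ m) i" if "i < n" for i
      using that by (auto simp: S_def)
    define h where "h i = (LEAST m. f ((f ^^ m) i) = (f ^^ m) i)" for i
    have "h (f i) < h i" if i: "i < n" "f i \<noteq> i" for i
    proof -
      obtain m where m: "f ((f ^^ m) i) = (f ^^ m) i" using ex[OF i(1)] by blast
      have "h i = Suc (LEAST m. f ((f ^^ Suc m) i) = (f ^^ Suc m) i)"
        unfolding h_def by (rule Least_Suc[where P = "\<lambda>m. f ((f ^^ m) i) = (f ^^ m) i", OF m]) (use i in simp)
      also have "(\<lambda>m. f ((f ^^ Suc m) i) = (f ^^ Suc m) i) = (\<lambda>m. f ((f ^^ m) (f i)) = (f ^^ m) (f i))"
        by (simp add: funpow_swap1)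
      finally show ?thesis by (simp add: h_def)
    qed
    with no_h show False by blast
  qed
  then obtain i0 where i0: "i0 < n" "i0 \<in> S" by blast
  have S_step: "f i \<in> S \<longleftrightarrow> i \<in> S" if "f i \<noteq> i" for i
  proof
    assume "f i \<in> S"
    show "i \<in> S" unfolding S_def
    proof (intro CollectI allI)
      fix m show "f ((f ^^ m) i) \<noteq> (f ^^ m) i"
        using \<open>f i \<in> S\<close> that by (cases m) (auto simp: S_def funpow_swap1)
    qed
  next
    assume i: "i \<in> S"
    show "f i \<in> S" unfolding S_def
    proof (intro CollectI allI)
      fix m
      from i have "f ((f ^^ Suc m) i) \<noteq> (f ^^ Suc m) i" unfolding S_def by blast
      then show "f ((f ^^ m) (f i)) \<noteq> (f ^^ m) (f i)" by (simp add: funpow_swap1)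
    qed
  qed
  define v where "v = Matrix.vec n (\<lambda>i. if i \<in> S then 1 else 0 :: 'a)"
  have "?M *\<^sub>v v = 0\<^sub>v n"
  proof (rule eq_vecI)
    fix i assume "i < dim_vec (0\<^sub>v n)"
    then have i: "i < n" by simp
    let ?x = "\<lambda>i. if i \<in> S then 1 else 0 :: 'a"
    have "vec_index (?M *\<^sub>v v) i = (\<Sum>j = 0..<n. (if j = i then 1 else if j = f i then - 1 else 0) * ?x j)"
      using i by (simp add: parent_matrix_def v_def scalar_prod_def)
    also have "\<dots> = (\<Sum>j = 0..<n. (if j = i then ?x i else 0)
                      + (if j = f i then if f i = i then 0 else - ?x (f i) else 0))"
      by (intro sum.cong refl) auto
    also have "\<dots> = ?x i + (if f i = i then 0 else - ?x (f i))"
      using i f[OF i] by (simp add: sum.distrib)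
    also have "\<dots> = 0"
    proof (cases "f i = i")
      case True
      then have "i \<notin> S" by (auto simp: S_def intro!: exI[of _ 0])
      then show ?thesis using True by simp
    next
      case False
      then show ?thesis using S_step[OF False] by simp
    qed
    finally show "vec_index (?M *\<^sub>v v) i = vec_index (0\<^sub>v n) i" using i by simp
  qed (simp add: parent_matrix_def)
  moreover have "v \<noteq> 0\<^sub>v n"
  proof
    assume "v = 0\<^sub>v n"
    then have "vec_index v i0 = 0" using i0 by simp
    then show False using i0 by (simp add: v_def)
  qed
  moreover have "v \<in> carrier_vec n" by (simp add: v_def)
  ultimately show ?thesis
    using det_0_iff_vec_prod_zero[OF parent_matrix_carrier] by blast
qed

lemma det_sum_rows:
  fixes B :: "nat \<Rightarrow> 'b \<Rightarrow> nat \<Rightarrow> 'a :: comm_ring_1"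
  assumes "finite C"
  shows "Determinant.det (Matrix.mat n n (\<lambda>(i, j). \<Sum>c\<in>C. B i c j)) =
    (\<Sum>f\<in>{..<n} \<rightarrow>\<^sub>E C. Determinant.det (Matrix.mat n n (\<lambda>(i, j). B i (f i) j)))"
proof -
  let ?P = "{p. p permutes {0..<n}}"
  have "Determinant.det (Matrix.mat n n (\<lambda>(i, j). \<Sum>c\<in>C. B i c j))
      = (\<Sum>p\<in>?P. signof p * (\<Prod>i = 0..<n. \<Sum>c\<in>C. B i c (p i)))"
    by (subst det_def'[of _ n]) (auto intro!: sum.cong prod.cong simp: permutes_in_image)
  also have "\<dots> = (\<Sum>p\<in>?P. signof p * (\<Sum>f\<in>{..<n} \<rightarrow>\<^sub>E C. \<Prod>i = 0..<n. B i (f i) (p i)))"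
    using assms by (simp add: prod_sum_PiE atLeast0LessThan)
  also have "\<dots> = (\<Sum>f\<in>{..<n} \<rightarrow>\<^sub>E C. \<Sum>p\<in>?P. signof p * (\<Prod>i = 0..<n. B i (f i) (p i)))"
    unfolding sum_distrib_left by (rule sum.swap)
  also have "\<dots> = (\<Sum>f\<in>{..<n} \<rightarrow>\<^sub>E C. Determinant.det (Matrix.mat n n (\<lambda>(i, j). B i (f i) j)))"
    by (intro sum.cong refl, subst det_def'[of _ n])
       (auto intro!: sum.cong prod.cong simp: permutes_in_image)
  finally show ?thesis .
qed

text \<open>
  Row \<open>i\<close> is \<open>e\<^sub>i\<close> plus the sum of \<open>e\<^sub>i - e\<^sub>j\<close> over the neighbours \<open>j\<close> of \<open>i\<close>. Expanding all rows
  multilinearly selects, for every vertex, either to be a root or one neighbour as its parent;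
  a selection contributes 1 when it is a parent map and 0 otherwise.
\<close>
theorem det_forest_matrix:
  assumes E: "\<And>e. e \<in> E \<Longrightarrow> e \<subseteq> {..<n} \<and> card e = 2"
  shows "Determinant.det (forest_matrix n E :: 'a :: idom Matrix.mat)
           = of_nat (card (rooted_spanning_forests {..<n} E))"
proof -
  let ?V = "{..<n}"
  \<comment> \<open>\<open>B i c\<close> is the summand of row \<open>i\<close> for parent \<open>c\<close>. It vanishes for a \<open>c\<close> that \<open>i\<close> may not choose,
     so that all rows can be expanded over the same index set.\<close>
  define B :: "nat \<Rightarrow> nat \<Rightarrow> nat \<Rightarrow> 'a" where
    "B i c j = (if c = i then (if j = i then 1 else 0)
                else if {i, c} \<in> E then (if j = i then 1 else if j = c then - 1 else 0) else 0)" for i c j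
  have noloop: "{i, i} \<notin> E" for i using E[of "{i, i}"] by auto
  have row: "(\<Sum>c<n. B i c j) = (if i = j then 1 + of_nat (card {v. {i, v} \<in> E})
                  else if {i, j} \<in> E then - 1 else 0)" if "i < n" "j < n" for i j
  proof (cases "i = j")
    case True
    have "(\<Sum>c<n. B i c j) = (\<Sum>c<n. (if c = i then 1 else 0) + (if {i, c} \<in> E then 1 else 0))"
      using True noloop by (intro sum.cong) (auto simp: B_def)
    also have "\<dots> = 1 + (\<Sum>c<n. if {i, c} \<in> E then 1 else 0)"
      using that by (simp add: sum.distrib)
    also have "(\<Sum>c<n. if {i, c} \<in> E then 1 else 0 :: 'a) = of_nat (card {v \<in> ?V. {i, v} \<in> E})"
      by (subst sum.inter_filter [symmetric]) auto
    also have "{v \<in> ?V. {i, v} \<in> E} = {v. {i, v} \<in> E}" using E by blast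
    finally show ?thesis using True by simp
  next
    case False
    have "(\<Sum>c<n. B i c j) = (\<Sum>c<n. if c = j then (if {i, j} \<in> E then - 1 else 0) else 0)"
      using False by (intro sum.cong) (auto simp: B_def)
    also have "\<dots> = (if {i, j} \<in> E then - 1 else 0)" using that by simp
    finally show ?thesis using False by simp
  qed
  have "forest_matrix n E = Matrix.mat n n (\<lambda>(i, j). \<Sum>c<n. B i c j)"
    unfolding forest_matrix_def by (rule eq_matI) (auto simp: row)
  then have "Determinant.det (forest_matrix n E :: 'a Matrix.mat)
      = (\<Sum>f\<in>?V \<rightarrow>\<^sub>E ?V. Determinant.det (Matrix.mat n n (\<lambda>(i, j). B i (f i) j)))"
    by (simp add: det_sum_rows)
  also have "\<dots> = (\<Sum>f\<in>?V \<rightarrow>\<^sub>E ?V. if f \<in> parent_maps ?V E then 1 else 0)"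
  proof (intro sum.cong refl)
    fix f assume f: "f \<in> ?V \<rightarrow>\<^sub>E ?V"
    let ?M = "Matrix.mat n n (\<lambda>(i, j). B i (f i) j)"
    show "Determinant.det ?M = (if f \<in> parent_maps ?V E then 1 else 0)"
    proof (cases "\<forall>i<n. f i \<noteq> i \<longrightarrow> {i, f i} \<in> E")
      case True
      then have M: "?M = parent_matrix n f"
        unfolding parent_matrix_def by (intro eq_matI) (auto simp: B_def)
      have fV: "f i < n" if "i < n" for i using f that by auto
      show ?thesis
      proof (cases "\<exists>h :: nat \<Rightarrow> nat. \<forall>i<n. f i \<noteq> i \<longrightarrow> h (f i) < h i")
        case h: True
        then have "f \<in> parent_maps ?V E" using f True by (auto simp: parent_maps_def)
        moreover from h obtain h :: "nat \<Rightarrow> nat" where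
          "\<And>i. i < n \<Longrightarrow> f i \<noteq> i \<Longrightarrow> h (f i) < h i" by blast
        ultimately show ?thesis unfolding M using det_parent_matrix_acyclic[of n f h] fV by simp
      next
        case h: False
        then have "f \<notin> parent_maps ?V E" by (auto simp: parent_maps_def)
        then show ?thesis unfolding M using det_parent_matrix_cyclic[of n f] fV h by simp
      qed
    next
      case False
      then obtain i where i: "i < n" "f i \<noteq> i" "{i, f i} \<notin> E" by blast
      have "Determinant.det ?M
          = (\<Sum>p | p permutes {0..<n}. signof p * (\<Prod>i = 0..<n. ?M $$ (i, p i)))"
        by (rule det_def') simp
      also have "\<dots> = 0"
      proof (intro sum.neutral ballI)
        fix p assume "p \<in> {p. p permutes {0..<n}}"
        then have "p i < n" using permutes_in_image[of p "{0..<n}" i] i by simp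
        then have "?M $$ (i, p i) = 0" using i by (simp add: B_def)
        then have "(\<Prod>i = 0..<n. ?M $$ (i, p i)) = 0" using i(1) by (intro prod_zero) auto
        then show "signof p * (\<Prod>i = 0..<n. ?M $$ (i, p i)) = 0" by simp
      qed
      finally show ?thesis using i by (auto simp: parent_maps_def)
    qed
  qed
  also have "\<dots> = of_nat (card {f \<in> ?V \<rightarrow>\<^sub>E ?V. f \<in> parent_maps ?V E})"
    by (subst sum.inter_filter [symmetric]) (auto simp: finite_PiE)
  also have "{f \<in> ?V \<rightarrow>\<^sub>E ?V. f \<in> parent_maps ?V E} = parent_maps ?V E"
    by (auto simp: parent_maps_def)
  finally show ?thesis using card_rooted_spanning_forests[OF E] by simp
qed

section \<open>Chebyshev polynomials\<close>

lemma chebyshev_T_0: "chebyshev_T 0 = 1"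
  by (rule poly_ext) (simp add: poly_chebyshev_T)

lemma chebyshev_T_1: "chebyshev_T (Suc 0) = [:0, 1:]"
  by (rule poly_ext) (simp add: poly_chebyshev_T)

lemma chebyshev_T_Suc_Suc:
  "chebyshev_T (Suc (Suc n)) = [:0, 2:] * chebyshev_T (Suc n) - chebyshev_T n"
proof (rule poly_ext)
  fix z :: complex
  define t where "t = Arccos z"
  define u where "u = of_nat (Suc n) * t"
  have z: "z = cos t" by (simp add: t_def)
  have eqs: "of_nat n * t = u - t" "of_nat (Suc (Suc n)) * t = u + t"
    by (simp_all add: u_def algebra_simps)
  show "poly (chebyshev_T (Suc (Suc n))) z = poly ([:0, 2:] * chebyshev_T (Suc n) - chebyshev_T n) z"
    unfolding poly_diff poly_mult poly_chebyshev_T t_def[symmetric] u_def[symmetric] eqs cos_add cos_diff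
    by (simp add: z)
qed

text \<open>
  Proved from the recurrence because \<open>Arccos (cos t)\<close> is \<open>t\<close> only up to sign and period.
\<close>
lemma poly_chebyshev_T_cos: "poly (chebyshev_T n) (cos t) = cos (of_nat n * t)"
proof (induction n rule: induct_nat_012)
  case 0
  show ?case by (simp add: chebyshev_T_0)
next
  case 1
  show ?case by (simp add: chebyshev_T_1)
next
  case (ge2 n)
  define u where "u = of_nat (Suc n) * t"
  have eqs: "of_nat n * t = u - t" "of_nat (Suc (Suc n)) * t = u + t"
    by (simp_all add: u_def algebra_simps)
  show ?case
    unfolding chebyshev_T_Suc_Suc poly_diff poly_mult ge2 u_def[symmetric] eqs cos_add cos_diff
    by simp
qed

lemma poly_chebyshev_T_of_real_cos:
  "poly (chebyshev_T n) (of_real (cos a)) = of_real (cos (real n * a))"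
proof -
  have "poly (chebyshev_T n) (of_real (cos a)) = cos (of_real (real n * a))"
    using poly_chebyshev_T_cos[of n "of_real a"] by (simp add: cos_of_real)
  then show ?thesis by (simp only: cos_of_real)
qed

lemma chebyshev_T_lead: "degree (chebyshev_T n) = n \<and> coeff (chebyshev_T n) n = 2 ^ (n - 1)"
proof (induction n rule: induct_nat_012)
  case 0
  show ?case by (simp add: chebyshev_T_0)
next
  case 1
  show ?case by (simp add: chebyshev_T_1)
next
  case (ge2 n)
  let ?T = "chebyshev_T (Suc n)"
  have c: "coeff (chebyshev_T (Suc (Suc n))) (Suc (Suc n)) = 2 ^ Suc n"
    using ge2 by (simp add: chebyshev_T_Suc_Suc coeff_eq_0)
  have "degree (chebyshev_T (Suc (Suc n))) \<le> Suc (Suc n)"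
    unfolding chebyshev_T_Suc_Suc
    by (intro degree_diff_le order_trans[OF degree_mult_le]) (use ge2 in auto)
  then show ?case using c le_degree[of "chebyshev_T (Suc (Suc n))" "Suc (Suc n)"] by simp
qed

lemma prod_diff_roots_unity:
  fixes x :: complex
  assumes "n > 0"
  shows "(\<Prod>m<n. x - cis (2 * pi * real m / real n)) = x ^ n - 1"
proof -
  define p :: "complex poly" where "p = monom 1 n - 1"
  have roots: "{z. poly p z = 0} = {z. z ^ n = 1}"
    by (auto simp: p_def poly_monom)
  have "rsquarefree p"
    using assms by (subst rsquarefree_roots) (auto simp: p_def poly_monom pderiv_diff pderiv_monom power_0_left)
  moreover have "coeff p n = 1" "degree p \<le> n"
    using assms by (auto simp: p_def intro!: degree_diff_le degree_monom_le)
  then have "lead_coeff p = 1" using le_degree[of p n] by simp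
  ultimately have "p = (\<Prod>z | z ^ n = 1. [:-z, 1:])"
    using complex_poly_decompose_rsquarefree[of p] roots by simp
  then have "poly p x = (\<Prod>z | z ^ n = 1. x - z)" by (simp add: poly_prod)
  also have "\<dots> = (\<Prod>m<n. x - cis (2 * pi * real m / real n))"
    by (rule prod.reindex_bij_betw [OF Complex.bij_betw_roots_unity [OF assms], symmetric])
  finally show ?thesis by (simp add: p_def poly_monom)
qed

text \<open>
  With \<open>x = exp (\<i> t)\<close>, a factor times \<open>x\<close> is \<open>(x - \<zeta>) (x - cnj \<zeta>)\<close> for a root of unity \<open>\<zeta>\<close>, and
  both halves of the product multiply to \<open>x\<^sup>n - 1\<close>.
\<close>
lemma prod_cos_diff:
  fixes t :: complex
  assumes "n > 0"
  shows "(\<Prod>m<n. 2 * cos t - 2 * of_real (cos (2 * pi * real m / real n)))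
           = 2 * cos (of_nat n * t) - 2"
proof -
  define x where "x = exp (\<i> * t)"
  define \<zeta> where "\<zeta> m = cis (2 * pi * real m / real n)" for m
  have x0: "x \<noteq> 0" by (simp add: x_def)
  have cosx: "x ^ k * (2 * cos (of_nat k * t)) = x ^ (2 * k) + 1" for k
    by (simp add: x_def cos_exp_eq exp_of_nat_mult [symmetric] distrib_left exp_add [symmetric] algebra_simps)
  have "x * (2 * cos t - 2 * of_real (cos (2 * pi * real m / real n))) = (x - \<zeta> m) * (x - cnj (\<zeta> m))" for m
  proof -
    have "2 * of_real (cos (2 * pi * real m / real n)) = \<zeta> m + cnj (\<zeta> m)"
      by (simp add: \<zeta>_def complex_add_cnj)
    moreover have "\<zeta> m * cnj (\<zeta> m) = 1"
      by (simp add: \<zeta>_def complex_norm_square [symmetric])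
    ultimately show ?thesis using cosx[of 1] by (simp add: algebra_simps power2_eq_square)
  qed
  note factor = this
  have "x ^ n * (\<Prod>m<n. 2 * cos t - 2 * of_real (cos (2 * pi * real m / real n)))
      = (\<Prod>m<n. x * (2 * cos t - 2 * of_real (cos (2 * pi * real m / real n))))"
    by (simp add: prod.distrib)
  also have "\<dots> = (\<Prod>m<n. x - \<zeta> m) * cnj (\<Prod>m<n. cnj x - \<zeta> m)"
    unfolding factor by (simp add: prod.distrib)
  also have "\<dots> = (x ^ n - 1) * (x ^ n - 1)"
    unfolding \<zeta>_def prod_diff_roots_unity [OF assms] by simp
  also have "\<dots> = x ^ n * (2 * cos (of_nat n * t) - 2)"
  proof -
    have "x ^ n * (2 * cos (of_nat n * t) - 2) = x ^ (2 * n) + 1 - 2 * x ^ n"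
      unfolding right_diff_distrib cosx by simp
    also have "x ^ (2 * n) = x ^ n * x ^ n" by (simp only: mult_2 power_add)
    finally show ?thesis by (simp add: left_diff_distrib right_diff_distrib)
  qed
  finally show ?thesis using x0 by simp
qed

lemma chebyshev_T_minus_2_prod:
  assumes "n > 0"
  shows "2 * poly (chebyshev_T n) w - 2
           = (\<Prod>m<n. 2 * w - 2 * of_real (cos (2 * pi * real m / real n)))"
  using prod_cos_diff[OF assms, of "Arccos w"] by (simp add: poly_chebyshev_T)

text \<open>Only the summand with the largest index \<open>s k\<close> reaches the top degree.\<close>
lemma chebyshev_sum_lead:
  fixes s :: "nat \<Rightarrow> nat"
  assumes k: "1 \<le> k" and s1: "1 \<le> s 1" and mono: "strict_mono_on {1..k} s"
  defines "P \<equiv> (\<Sum>j=1..k. 2 * chebyshev_T (s j) - 2) - 1"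
  shows "degree P = s k" and "lead_coeff P = 2 ^ s k"
proof -
  have less: "s j < s k" if "1 \<le> j" "j < k" for j
    using strict_mono_onD[OF mono, of j k] that by simp
  have pos: "s k \<ge> 1"
    using less[of 1] s1 k by (cases "k = 1") auto
  have two: "2 * p - 2 = Polynomial.smult 2 p - [:2:]" for p :: "complex poly"
    by (simp add: numeral_poly)
  have c: "coeff (2 * chebyshev_T (s j) - 2) (s k) = (if j = k then 2 ^ s k else 0)"
    if "j \<in> {1..k}" for j
  proof (cases "j = k")
    case True
    have "coeff [:2 :: complex:] (s k) = 0" using pos by (cases "s k") auto
    moreover have "2 * 2 ^ (s k - 1) = (2 ^ s k :: complex)"
      using pos by (cases "s k") auto
    ultimately show ?thesis unfolding two using True chebyshev_T_lead[of "s k"] by simp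
  next
    case False
    then have "s j < s k" using less that by auto
    moreover have "coeff [:2 :: complex:] (s k) = 0" using pos by (cases "s k") auto
    ultimately show ?thesis unfolding two
      using False chebyshev_T_lead[of "s j"] by (simp add: coeff_eq_0)
  qed
  have "coeff (1 :: complex poly) (s k) = 0" using pos by simp
  then have "coeff P (s k) = (\<Sum>j=1..k. coeff (2 * chebyshev_T (s j) - 2) (s k))"
    by (simp only: P_def coeff_diff coeff_sum) simp
  also have "\<dots> = (\<Sum>j=1..k. if j = k then 2 ^ s k else 0)"
    by (rule sum.cong) (simp_all only: c)
  also have "\<dots> = 2 ^ s k" using k by simp
  finally have lead: "coeff P (s k) = 2 ^ s k" .
  have "degree P \<le> s k" unfolding P_def
  proof (intro degree_diff_le[OF degree_sum_le])
    fix j assume "j \<in> {1..k}"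
    then have "s j \<le> s k" using less[of j] by (cases "j = k") auto
    then show "degree (2 * chebyshev_T (s j) - 2) \<le> s k" unfolding two
      using chebyshev_T_lead[of "s j"] by (intro degree_diff_le) auto
  qed auto
  then show "degree P = s k" using lead le_degree[of P "s k"] by simp
  with lead show "lead_coeff P = 2 ^ s k" by simp
qed

section \<open>The spectrum of a circulant graph\<close>

definition character :: "nat \<Rightarrow> nat \<Rightarrow> int \<Rightarrow> complex" where
  "character n m x = cis (2 * pi * real m * real_of_int x / real n)"

lemma character_add: "character n m (x + y) = character n m x * character n m y"
  by (simp add: character_def cis_mult distrib_left add_divide_distrib)

lemma character_mod:
  assumes "n > 0"
  shows "character n m (x mod int n) = character n m x"
proof -
  have "character n m (int n * (x div int n)) = cis (2 * pi * of_int (int m * (x div int n)))"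
    using assms by (simp add: character_def field_simps)
  also have "\<dots> = 1" by (rule cis_multiple_2pi) simp
  finally show ?thesis
    using character_add[of n m "int n * (x div int n)" "x mod int n"] by simp
qed

lemma character_power: "character n m (int j) = cis (2 * pi * real m / real n) ^ j"
  by (simp add: character_def Complex.DeMoivre mult_ac)

lemma character_add_minus:
  "character n m x + character n m (- x) = of_real (2 * cos (2 * pi * real m * real_of_int x / real n))"
proof -
  have "character n m (- x) = cnj (character n m x)" by (simp add: character_def cis_cnj)
  then show ?thesis by (simp only: complex_add_cnj) (simp add: character_def)
qed

definition fourier_matrix :: "nat \<Rightarrow> complex Matrix.mat" where
  "fourier_matrix n = Matrix.mat n n (\<lambda>(j, m). character n m (int j))"

lemma fourier_matrix_carrier [simp]: "fourier_matrix n \<in> carrier_mat n n"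
  by (simp add: fourier_matrix_def)

lemma sum_character_orthogonal:
  assumes "a < n" "b < n"
  shows "(\<Sum>j<n. cnj (character n a (int j)) * character n b (int j)) = (if a = b then of_nat n else 0)"
proof -
  define z where "z a = cis (2 * pi * real a / real n)" for a
  have n: "n > 0" using assms by simp
  have zn: "z a ^ n = 1" and zz: "z a * cnj (z a) = 1" for a
    using n by (simp_all add: z_def Complex.DeMoivre flip: complex_norm_square)
  define q where "q = cnj (z a) * z b"
  have "(\<Sum>j<n. cnj (character n a (int j)) * character n b (int j)) = (\<Sum>j<n. q ^ j)"
    by (simp add: character_power q_def z_def power_mult_distrib)
  also have "\<dots> = (if a = b then of_nat n else 0)"
  proof (cases "a = b")
    case True
    have "q = 1" unfolding q_def True by (subst mult.commute) (rule zz)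
    then show ?thesis using True by simp
  next
    case False
    have "inj_on z {..<n}"
      unfolding z_def by (rule bij_betw_imp_inj_on[OF Complex.bij_betw_roots_unity[OF n]])
    then have "z a \<noteq> z b" using False assms by (auto dest: inj_onD)
    moreover have "z a * q = z b" using zz by (simp add: q_def flip: mult.assoc)
    ultimately have "q \<noteq> 1" by auto
    moreover have "q ^ n = cnj (z a ^ n) * z b ^ n" by (simp add: q_def power_mult_distrib)
    then have "q ^ n = 1" by (simp only: zn) simp
    ultimately show ?thesis using False by (simp add: sum_gp_strict)
  qed
  finally show ?thesis .
qed

text \<open>By orthogonality of the characters the conjugate transpose is an inverse up to the factor \<open>n\<close>.\<close>
lemma det_fourier_matrix_nonzero: "Determinant.det (fourier_matrix n) \<noteq> 0"
proof -
  define G where "G = Matrix.mat n n (\<lambda>(m, j). cnj (character n m (int j)))"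
  have G: "G \<in> carrier_mat n n" by (simp add: G_def)
  have "G * fourier_matrix n = of_nat n \<cdot>\<^sub>m 1\<^sub>m n"
  proof (rule eq_matI)
    fix a b assume "a < dim_row (of_nat n \<cdot>\<^sub>m 1\<^sub>m n :: complex Matrix.mat)"
      "b < dim_col (of_nat n \<cdot>\<^sub>m 1\<^sub>m n :: complex Matrix.mat)"
    then have ab: "a < n" "b < n" by simp_all
    then have "(G * fourier_matrix n) $$ (a, b)
        = (\<Sum>j<n. cnj (character n a (int j)) * character n b (int j))"
      by (simp add: G_def fourier_matrix_def scalar_prod_def atLeast0LessThan)
    then show "(G * fourier_matrix n) $$ (a, b) = (of_nat n \<cdot>\<^sub>m 1\<^sub>m n :: complex Matrix.mat) $$ (a, b)"
      using ab by (simp add: sum_character_orthogonal)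
  qed (simp_all add: G_def fourier_matrix_def)
  then have "Determinant.det G * Determinant.det (fourier_matrix n) = of_nat n ^ n"
    using det_mult[OF G fourier_matrix_carrier] by (simp add: Determinant.det_smult)
  then show ?thesis by (cases "n = 0") auto
qed

text \<open>
  The hypothesis on \<open>A\<close> says that every column of the Fourier matrix is an eigenvector, and these
  columns form a basis.
\<close>
lemma det_diagonalised:
  assumes A: "A \<in> carrier_mat n n"
    and ev: "\<And>i m. i < n \<Longrightarrow> m < n \<Longrightarrow>
      (\<Sum>j<n. A $$ (i, j) * character n m (int j)) = character n m (int i) * \<mu> m"
  shows "Determinant.det A = (\<Prod>m<n. \<mu> m)"
proof -
  define D where "D = Matrix.mat n n (\<lambda>(i, j). if i = j then \<mu> j else 0)"
  have D: "D \<in> carrier_mat n n" by (simp add: D_def)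
  let ?F = "fourier_matrix n"
  have "A * ?F = ?F * D"
  proof (rule eq_matI)
    fix i m assume "i < dim_row (?F * D)" "m < dim_col (?F * D)"
    then have im: "i < n" "m < n" by (simp_all add: D_def fourier_matrix_def)
    have "(A * ?F) $$ (i, m) = (\<Sum>j<n. A $$ (i, j) * character n m (int j))"
      using im A by (simp add: fourier_matrix_def scalar_prod_def atLeast0LessThan)
    also have "\<dots> = (\<Sum>j<n. character n j (int i) * (if j = m then \<mu> m else 0))"
    proof -
      have "(\<Sum>j<n. character n j (int i) * (if j = m then \<mu> m else 0))
          = (\<Sum>j<n. if j = m then character n m (int i) * \<mu> m else 0)"
        by (rule sum.cong) auto
      then show ?thesis using im by (simp add: ev)
    qed
    also have "\<dots> = (?F * D) $$ (i, m)"
      using im by (simp add: fourier_matrix_def D_def scalar_prod_def atLeast0LessThan)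
    finally show "(A * ?F) $$ (i, m) = (?F * D) $$ (i, m)" .
  qed (use A in \<open>simp_all add: D_def fourier_matrix_def\<close>)
  then have "Determinant.det A * Determinant.det ?F = Determinant.det ?F * Determinant.det D"
    using det_mult[OF A fourier_matrix_carrier] det_mult[OF fourier_matrix_carrier D] by argo
  then have "Determinant.det A = Determinant.det D"
    using det_fourier_matrix_nonzero[of n] by simp
  also have "\<dots> = prod_list (diag_mat D)"
    by (rule det_upper_triangular[OF _ D]) (auto simp: D_def)
  also have "\<dots> = (\<Prod>m<n. \<mu> m)"
    by (simp add: prod_list_diag_prod D_def atLeast0LessThan)
  finally show ?thesis .
qed

lemma circulant_edges_pairs:
  assumes S: "\<And>d. d \<in> S \<Longrightarrow> 1 \<le> d \<and> 2 * d < n" and e: "e \<in> circulant_edges n S"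
  shows "e \<subseteq> {..<n} \<and> card e = 2"
proof -
  have S': "1 \<le> d \<and> 2 * d \<le> n" if "d \<in> S" for d using S[OF that] by simp
  show ?thesis using circulant_edges_simple[of S n, OF S' e] by (simp add: circulant_verts_def)
qed

definition signed_offsets :: "nat set \<Rightarrow> int set" where
  "signed_offsets S = int ` S \<union> (\<lambda>d. - int d) ` S"

lemma sum_signed_offsets:
  fixes g :: "int \<Rightarrow> 'a :: comm_monoid_add"
  assumes "finite S" and "0 \<notin> S"
  shows "(\<Sum>x\<in>signed_offsets S. g x) = (\<Sum>d\<in>S. g (int d) + g (- int d))"
proof -
  have "int ` S \<inter> (\<lambda>d. - int d) ` S = {}"
  proof -
    have "x = 0" if "int x = - int d" for x d using that by linarith
    then show ?thesis using assms(2) by blast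
  qed
  moreover have "inj_on int S" "inj_on (\<lambda>d. - int d) S" by (auto intro!: inj_onI)
  ultimately show ?thesis
    using assms(1) by (simp add: signed_offsets_def sum.union_disjoint sum.reindex sum.distrib)
qed

text \<open>
  All signed offsets have absolute value below \<open>n / 2\<close>, so they are pairwise incongruent modulo \<open>n\<close>;
  every vertex thus has exactly one neighbour per offset.
\<close>
lemma bij_betw_circulant_neighbours:
  assumes i: "i < n" and S: "\<And>d. d \<in> S \<Longrightarrow> 1 \<le> d \<and> 2 * d < n"
  shows "bij_betw (\<lambda>x. nat ((int i + x) mod int n)) (signed_offsets S) {v. {i, v} \<in> circulant_edges n S}"
  unfolding bij_betw_def
proof
  have n: "n > 0" using i by simp
  have small: "2 * \<bar>x\<bar> < int n" if "x \<in> signed_offsets S" for x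
    using that S by (fastforce simp: signed_offsets_def)
  show "inj_on (\<lambda>x. nat ((int i + x) mod int n)) (signed_offsets S)"
  proof (rule inj_onI)
    fix x y assume xy: "x \<in> signed_offsets S" "y \<in> signed_offsets S"
      "nat ((int i + x) mod int n) = nat ((int i + y) mod int n)"
    then have "(int i + x) mod int n = (int i + y) mod int n"
      using n by (simp add: eq_nat_nat_iff)
    then have "int n dvd x - y" by (simp add: mod_eq_dvd_iff)
    moreover have "\<bar>x - y\<bar> < int n" using small[OF xy(1)] small[OF xy(2)] by linarith
    ultimately have "x - y = 0" using dvd_imp_le_int[of "x - y" "int n"] by (cases "x - y = 0") simp_all
    then show "x = y" by simp
  qed
  have edge: "{i, v} \<in> circulant_edges n S \<longleftrightarrow>
      v < n \<and> (\<exists>x\<in>signed_offsets S. int v = (int i + x) mod int n)" for v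
  proof
    assume "{i, v} \<in> circulant_edges n S"
    then obtain a b d where ab: "{i, v} = {a, b}" "a < n" "b < n" "d \<in> S"
      "[int b = int a + int d] (mod int n) \<or> [int b = int a - int d] (mod int n)"
      unfolding circulant_edges_def by blast
    have "v < n" using ab by (auto simp: doubleton_eq_iff)
    have "\<exists>x\<in>signed_offsets S. [int v = int i + x] (mod int n)"
    proof (cases "i = a \<and> v = b")
      case True
      then show ?thesis using ab(4,5) by (auto simp: signed_offsets_def bex_Un)
    next
      case False
      then have "i = b" "v = a" using ab(1) by (auto simp: doubleton_eq_iff)
      moreover have "[int a = int b - int d] (mod int n) \<or> [int a = int b + int d] (mod int n)"
      proof -
        have "int a - (int b - int d) = - (int b - (int a + int d))"
          "int a - (int b + int d) = - (int b - (int a - int d))" by simp_all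
        then show ?thesis using ab(5) unfolding cong_iff_dvd_diff by (metis dvd_minus_iff)
      qed
      ultimately show ?thesis using ab(4) by (auto simp: signed_offsets_def bex_Un)
    qed
    then show "v < n \<and> (\<exists>x\<in>signed_offsets S. int v = (int i + x) mod int n)"
      using \<open>v < n\<close> by (auto simp: cong_def)
  next
    assume "v < n \<and> (\<exists>x\<in>signed_offsets S. int v = (int i + x) mod int n)"
    then obtain x where v: "v < n" and x: "x \<in> signed_offsets S" "[int v = int i + x] (mod int n)"
      by (auto simp: cong_def)
    from x obtain d where "d \<in> S"
      "[int v = int i + int d] (mod int n) \<or> [int v = int i - int d] (mod int n)"
      by (auto simp: signed_offsets_def)
    with i v show "{i, v} \<in> circulant_edges n S" unfolding circulant_edges_def by blast
  qed
  show "(\<lambda>x. nat ((int i + x) mod int n)) ` signed_offsets S = {v. {i, v} \<in> circulant_edges n S}"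
  proof (intro equalityI subsetI)
    fix v assume "v \<in> (\<lambda>x. nat ((int i + x) mod int n)) ` signed_offsets S"
    then obtain x where "x \<in> signed_offsets S" "v = nat ((int i + x) mod int n)" by blast
    then show "v \<in> {v. {i, v} \<in> circulant_edges n S}"
      using n edge by (auto simp: nat_less_iff)
  next
    fix v assume "v \<in> {v. {i, v} \<in> circulant_edges n S}"
    then obtain x where "x \<in> signed_offsets S" "int v = (int i + x) mod int n" using edge by auto
    then show "v \<in> (\<lambda>x. nat ((int i + x) mod int n)) ` signed_offsets S"
      by (intro image_eqI[of _ _ x]) (metis nat_int)+
  qed
qed

text \<open>
  The neighbours of \<open>i\<close> are its translates by the signed offsets, so every character of the cyclic
  group is an eigenvector; pairing an offset with its negative turns the eigenvalue into cosines.
\<close>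
theorem det_forest_matrix_circulant:
  assumes S: "\<And>d. d \<in> S \<Longrightarrow> 1 \<le> d \<and> 2 * d < n"
  shows "Determinant.det (forest_matrix n (circulant_edges n S))
    = (\<Prod>m<n. 1 + (\<Sum>d\<in>S. 2 - 2 * complex_of_real (cos (2 * pi * real m * real d / real n))))"
proof (rule det_diagonalised)
  let ?E = "circulant_edges n S"
  show "forest_matrix n ?E \<in> carrier_mat n n" by (simp add: forest_matrix_def)
  have finS: "finite S" by (rule finite_subset[of _ "{..n}"]) (use S in fastforce)+
  have S0: "0 \<notin> S" using S[of 0] by auto
  fix i m assume i: "i < n" and "m < n"
  let ?\<chi> = "character n m"
  let ?N = "{v. {i, v} \<in> ?E}"
  have n: "n > 0" using i by simp
  note bij = bij_betw_circulant_neighbours[OF i S]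
  have N: "?N \<subseteq> {..<n}" "i \<notin> ?N" using circulant_edges_pairs[of S n, OF S] by fastforce+
  have degree: "of_nat (card ?N) = (\<Sum>d\<in>S. 2 :: complex)"
  proof -
    have "of_nat (card ?N) = (\<Sum>x\<in>signed_offsets S. 1 :: complex)"
      by (simp add: bij_betw_same_card[OF bij])
    also have "\<dots> = (\<Sum>d\<in>S. 2)" by (subst sum_signed_offsets[OF finS S0]) simp
    finally show ?thesis .
  qed
  have nbrs: "(\<Sum>j\<in>?N. ?\<chi> (int j))
      = ?\<chi> (int i) * (\<Sum>d\<in>S. 2 * of_real (cos (2 * pi * real m * real d / real n)))"
  proof -
    have "(\<Sum>j\<in>?N. ?\<chi> (int j)) = (\<Sum>x\<in>signed_offsets S. ?\<chi> (int (nat ((int i + x) mod int n))))"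
      by (rule sum.reindex_bij_betw[OF bij, symmetric])
    also have "\<dots> = (\<Sum>x\<in>signed_offsets S. ?\<chi> (int i) * ?\<chi> x)"
      using n by (intro sum.cong) (simp_all add: character_mod character_add)
    also have "\<dots> = ?\<chi> (int i) * (\<Sum>d\<in>S. ?\<chi> (int d) + ?\<chi> (- int d))"
      by (simp add: sum_signed_offsets[OF finS S0] flip: sum_distrib_left)
    finally show ?thesis by (simp add: character_add_minus)
  qed
  have "(\<Sum>j<n. forest_matrix n ?E $$ (i, j) * ?\<chi> (int j))
      = (\<Sum>j<n. (if j = i then (1 + of_nat (card ?N)) * ?\<chi> (int i) else 0)
               - (if j \<in> ?N then ?\<chi> (int j) else 0))"
    using i N(2) by (intro sum.cong) (auto simp: forest_matrix_def)
  also have "\<dots> = (1 + of_nat (card ?N)) * ?\<chi> (int i) - (\<Sum>j\<in>?N. ?\<chi> (int j))"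
  proof -
    have "(\<Sum>j<n. if j \<in> ?N then ?\<chi> (int j) else 0) = (\<Sum>j\<in>{..<n} \<inter> ?N. ?\<chi> (int j))"
      by (rule sum.inter_restrict[symmetric]) simp
    moreover have "{..<n} \<inter> ?N = ?N" using N(1) by blast
    ultimately show ?thesis using i by (simp add: sum_subtractf)
  qed
  also have "\<dots> = ?\<chi> (int i) * (1 + (\<Sum>d\<in>S. 2 - 2 * of_real (cos (2 * pi * real m * real d / real n))))"
    unfolding nbrs degree by (simp add: sum_subtractf algebra_simps)
  finally show "(\<Sum>j<n. forest_matrix n ?E $$ (i, j) * ?\<chi> (int j))
      = ?\<chi> (int i) * (1 + (\<Sum>d\<in>S. 2 - 2 * of_real (cos (2 * pi * real m * real d / real n))))" .
qed

section \<open>The number of rooted spanning forests of a circulant graph\<close>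

theorem theorem1:
  fixes k n :: nat and s :: "nat \<Rightarrow> nat"
  assumes "1 \<le> k"
    and "1 \<le> s 1"
    and "strict_mono_on {1..k} s"
    and "2 * s k < n"
  defines "P \<equiv> (\<Sum>j=1..k. 2 * chebyshev_T (s j) - 2) - 1"
  shows "size (proots P) = s k \<and>
    real (card (rooted_spanning_forests (circulant_verts n) (circulant_edges n (s ` {1..k}))))
      = (\<Prod>w\<in>#proots P. cmod (2 * poly (chebyshev_T n) w - 2))"
proof
  have degP: "degree P = s k" and leadP: "lead_coeff P = 2 ^ s k"
    using chebyshev_sum_lead[OF assms(1-3)] unfolding P_def by blast+
  show size: "size (proots P) = s k" by (simp add: size_proots_complex degP)
  let ?S = "s ` {1..k}"
  let ?c = "\<lambda>m. complex_of_real (cos (2 * pi * real m / real n))"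
  have n: "n > 0" using assms(4) by simp
  have S: "1 \<le> d \<and> 2 * d < n" if "d \<in> ?S" for d
  proof -
    from that obtain j where j: "1 \<le> j" "j \<le> k" "d = s j" by auto
    have mono: "mono_on {1..k} s" using assms(3) by (rule strict_mono_on_imp_mono_on)
    have "s 1 \<le> s j" "s j \<le> s k" using mono_onD[OF mono] j assms(1) by auto
    then show ?thesis using assms(2,4) j by simp
  qed
  have "inj_on s {1..k}" using assms(3) by (rule strict_mono_on_imp_inj_on)
  then have eigenvalue: "1 + (\<Sum>d\<in>?S. 2 - 2 * complex_of_real (cos (2 * pi * real m * real d / real n)))
      = - poly P (?c m)" for m
  proof -
    have "poly (chebyshev_T j) (?c m) = of_real (cos (2 * pi * real m * real j / real n))" for j
      unfolding poly_chebyshev_T_of_real_cos by (simp add: mult_ac)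
    then have "poly P (?c m)
        = (\<Sum>j=1..k. 2 * of_real (cos (2 * pi * real m * real (s j) / real n)) - 2) - 1"
      by (simp add: P_def poly_sum)
    with \<open>inj_on s {1..k}\<close> show ?thesis
      by (simp add: sum.reindex sum_subtractf card_image)
  qed
  \<comment> \<open>The leading coefficient \<open>2 ^ s k\<close> supplies exactly one factor 2 for each of the \<open>s k\<close> roots.\<close>
  have factor: "poly P z = (\<Prod>w\<in>#proots P. 2 * (z - w))" for z
  proof -
    have "poly P z = 2 ^ s k * (\<Prod>w\<in>#proots P. z - w)"
      using arg_cong[OF complex_poly_decompose_multiset[of P], of "\<lambda>p. poly p z"]
      by (simp add: leadP poly_prod_mset image_mset.compositionality o_def)
    also have "\<dots> = (\<Prod>w\<in>#proots P. 2) * (\<Prod>w\<in>#proots P. z - w)"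
      by (simp add: size)
    finally show ?thesis by (simp only: prod_mset.distrib)
  qed
  have "complex_of_nat (card (rooted_spanning_forests (circulant_verts n) (circulant_edges n ?S)))
      = Determinant.det (forest_matrix n (circulant_edges n ?S))"
    unfolding circulant_verts_def
    by (rule det_forest_matrix[symmetric]) (rule circulant_edges_pairs[OF S])
  also have "\<dots> = (\<Prod>m<n. - poly P (?c m))"
    using det_forest_matrix_circulant[of ?S n, OF S] by (simp only: eigenvalue)
  finally have "complex_of_nat (card (rooted_spanning_forests (circulant_verts n) (circulant_edges n ?S)))
      = (\<Prod>m<n. - poly P (?c m))" .
  then have "real (card (rooted_spanning_forests (circulant_verts n) (circulant_edges n ?S)))
      = cmod (\<Prod>m<n. - poly P (?c m))"
    by (metis norm_of_nat)
  also have "\<dots> = (\<Prod>m<n. \<Prod>w\<in>#proots P. cmod (2 * w - 2 * ?c m))"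
  proof -
    have "cmod (- poly P z) = (\<Prod>w\<in>#proots P. cmod (2 * w - 2 * z))" for z
    proof -
      have "cmod (prod_mset (image_mset g M)) = (\<Prod>w\<in>#M. cmod (g w))" for g :: "complex \<Rightarrow> complex" and M
        by (induction M) (simp_all add: norm_mult)
      then have "cmod (- poly P z) = (\<Prod>w\<in>#proots P. cmod (2 * (z - w)))"
        unfolding norm_minus_cancel factor .
      also have "(\<lambda>w. cmod (2 * (z - w))) = (\<lambda>w. cmod (2 * w - 2 * z))"
        by (subst norm_minus_commute) (simp only: right_diff_distrib)
      finally show ?thesis .
    qed
    then show ?thesis by (simp only: prod_norm [symmetric])
  qed
  also have "\<dots> = (\<Prod>w\<in>#proots P. \<Prod>m<n. cmod (2 * w - 2 * ?c m))"
  proof -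
    have "(\<Prod>m<n. \<Prod>w\<in>#M. g m w) = (\<Prod>w\<in>#M. \<Prod>m<n. g m w)" for g :: "nat \<Rightarrow> complex \<Rightarrow> real" and M
      by (induction M) (simp_all add: prod.distrib)
    then show ?thesis .
  qed
  also have "\<dots> = (\<Prod>w\<in>#proots P. cmod (2 * poly (chebyshev_T n) w - 2))"
    by (simp only: chebyshev_T_minus_2_prod[OF n] prod_norm)
  finally show "real (card (rooted_spanning_forests (circulant_verts n) (circulant_edges n ?S)))
      = (\<Prod>w\<in>#proots P. cmod (2 * poly (chebyshev_T n) w - 2))" .
qed

end
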